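(* Let $R_0\in\mathrm{SO}(3)$ and $k_{\rm e}>0$. Let $K_P,K_I,K_D\in\mathbb R^{3\times3}$ be any three matrices such that the polynomial in $\lambda$ $$\det(\lambda^3I+\lambda^2K_D+\lambda K_P+K_I)$$ is Hurwitz. Then the linear PID controller $$u=-K_P\,\mathrm{Skew}(R_0^T\Delta R)^\vee-K_D\Omega-K_I\int_0^t\mathrm{Skew}(R_0^T\Delta R(\tau))^\vee\,d\tau,\qquad\Delta R=R-R_0,$$ exponentially stabilizes the equilibrium point $(R,\Omega)=(R_0,0)$ (i.e. $(\Delta R,\Omega)=(0,0)$) for the linear system $$\Delta\dot R=R_0\hat\Omega-2k_{\rm e}R_0\,\mathrm{Sym}(R_0^T\Delta R),\qquad\dot\Omega=u,\qquad(\Delta R,\Omega)\in\mathbb R^{3\times3}\times\mathbb R^3.$$ Moreover, it exponentially stabilizes the equilibrium point $(R_0,0)$ for the rigid body system $$\dot R=R\hat\Omega,\qquad\dot\Omega=u,\qquad(R,\Omega)\in\mathrm{SO}(3)\times\mathbb R^3.$$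
   Context: $\mathrm{Sym}(A)=\frac12(A+A^T)$ and $\mathrm{Skew}(A)=\frac12(A-A^T)$ for a square matrix $A$. The hat map $\wedge:\mathbb R^3\to\mathfrak{so}(3)$ sends $\Omega=(\Omega_1,\Omega_2,\Omega_3)$ to $\hat\Omega=\begin{bmatrix}0&-\Omega_3&\Omega_2\\ \Omega_3&0&-\Omega_1\\ -\Omega_2&\Omega_1&0\end{bmatrix}$, and $\vee:\mathfrak{so}(3)\to\mathbb R^3$ is its inverse. A polynomial is Hurwitz if all its roots have negative real part. The PID controller is dynamic feedback whose internal state is the integral term, which is zero at the initial time $t=0$. It exponentially stabilizes an equilibrium $x_0$ if there are $C,c,\delta>0$ such that every closed-loop solution in the stated state space starting at time $0$ with $\|x(0)-x_0\|<\delta$ satisfies $\|x(t)-x_0\|\le Ce^{-ct}\|x(0)-x_0\|$ for all $t\ge0$, where $\|\cdot\|$ is the Euclidean (Frobenius) norm of $\mathbb R^{3\times3}\times\mathbb R^3$. Stability is understood locally. *)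

theory Defs
  imports "HOL-Analysis.Analysis" "HOL-Computational_Algebra.Polynomial"
begin

definition Sym :: "real^'n^'n \<Rightarrow> real^'n^'n" where
  "Sym A = (1/2) *\<^sub>R (A + transpose A)"

definition Skew :: "real^'n^'n \<Rightarrow> real^'n^'n" where
  "Skew A = (1/2) *\<^sub>R (A - transpose A)"

definition hat :: "real^3 \<Rightarrow> real^3^3" where
  "hat \<Omega> = vector [vector [0, - \<Omega>$3, \<Omega>$2],
                   vector [\<Omega>$3, 0, - \<Omega>$1],
                   vector [- \<Omega>$2, \<Omega>$1, 0]]"

text \<open>Only meaningful on the range of \<^const>\<open>hat\<close>, the skew-symmetric matrices.\<close>

definition vee :: "real^3^3 \<Rightarrow> real^3" where
  "vee = inv hat"

definition SO3 :: "(real^3^3) set" where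
  "SO3 = {R. rotation_matrix R}"

definition hurwitz :: "real poly \<Rightarrow> bool" where
  "hurwitz p \<longleftrightarrow> (\<forall>z::complex. poly (map_poly complex_of_real p) z = 0 \<longrightarrow> Re z < 0)"

text \<open>The determinant is taken over the polynomial ring: the matrix entries are polynomials
  in \<open>\<lambda>\<close>, with coefficients listed from the constant term upwards.\<close>

definition pid_poly :: "real^3^3 \<Rightarrow> real^3^3 \<Rightarrow> real^3^3 \<Rightarrow> real poly" where
  "pid_poly K\<^sub>P K\<^sub>I K\<^sub>D =
     det (\<chi> i j. [:K\<^sub>I$i$j, K\<^sub>P$i$j, K\<^sub>D$i$j, (mat 1 :: real^3^3)$i$j:])"

text \<open>A control system has a state space \<open>S\<close> and dynamics \<open>x' = f x u\<close>. A dynamic feedback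
  \<open>\<kappa>\<close> maps a state trajectory and a time to a control value, so that it may depend on the
  history of the trajectory since time 0.\<close>

definition closed_loop_solution ::
  "'x::real_normed_vector set \<Rightarrow> ('x \<Rightarrow> 'u \<Rightarrow> 'x) \<Rightarrow> ((real \<Rightarrow> 'x) \<Rightarrow> real \<Rightarrow> 'u) \<Rightarrow> (real \<Rightarrow> 'x) \<Rightarrow> bool"
  where
  "closed_loop_solution S f \<kappa> x \<longleftrightarrow>
     (\<forall>t\<ge>0. x t \<in> S \<and> (x has_vector_derivative f (x t) (\<kappa> x t)) (at t within {0..}))"

definition exponentially_stabilizes ::
  "'x::real_normed_vector set \<Rightarrow> ('x \<Rightarrow> 'u \<Rightarrow> 'x) \<Rightarrow> ((real \<Rightarrow> 'x) \<Rightarrow> real \<Rightarrow> 'u) \<Rightarrow> 'x \<Rightarrow> bool"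
  where
  "exponentially_stabilizes S f \<kappa> x\<^sub>0 \<longleftrightarrow>
     closed_loop_solution S f \<kappa> (\<lambda>_. x\<^sub>0) \<and>
     (\<exists>C>0. \<exists>c>0. \<exists>\<delta>>0. \<forall>x. closed_loop_solution S f \<kappa> x \<longrightarrow> norm (x 0 - x\<^sub>0) < \<delta> \<longrightarrow>
        (\<forall>t\<ge>0. norm (x t - x\<^sub>0) \<le> C * exp (- c * t) * norm (x 0 - x\<^sub>0)))"

definition pid_control ::
  "real^3^3 \<Rightarrow> real^3^3 \<Rightarrow> real^3^3 \<Rightarrow> real^3^3 \<Rightarrow>
   (real \<Rightarrow> real^3^3) \<Rightarrow> (real \<Rightarrow> real^3) \<Rightarrow> real \<Rightarrow> real^3" where
  "pid_control R\<^sub>0 K\<^sub>P K\<^sub>I K\<^sub>D \<Delta>R \<Omega> t =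
     - (K\<^sub>P *v vee (Skew (transpose R\<^sub>0 ** \<Delta>R t))) - K\<^sub>D *v \<Omega> t
     - K\<^sub>I *v integral {0..t} (\<lambda>\<tau>. vee (Skew (transpose R\<^sub>0 ** \<Delta>R \<tau>)))"

definition linear_system ::
  "real^3^3 \<Rightarrow> real \<Rightarrow> (real^3^3) \<times> (real^3) \<Rightarrow> real^3 \<Rightarrow> (real^3^3) \<times> (real^3)" where
  "linear_system R\<^sub>0 k\<^sub>e = (\<lambda>(\<Delta>R, \<Omega>) u.
     (R\<^sub>0 ** hat \<Omega> - (2 * k\<^sub>e) *\<^sub>R (R\<^sub>0 ** Sym (transpose R\<^sub>0 ** \<Delta>R)), u))"

definition rigid_body_system ::
  "(real^3^3) \<times> (real^3) \<Rightarrow> real^3 \<Rightarrow> (real^3^3) \<times> (real^3)" where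
  "rigid_body_system = (\<lambda>(R, \<Omega>) u. (R ** hat \<Omega>, u))"

end

theory Submission
  imports Defs "HOL-Computational_Algebra.Fundamental_Theorem_Algebra"
begin

text \<open>
  In both systems the PID loop lives in the coordinates \<open>y = (E, e, \<Omega>)\<close>, where
  \<open>Z = R\<^sub>0\<^sup>T \<Delta>R\<close>, \<open>e\<close> is the axial vector of \<open>Skew Z\<close> and \<open>E\<close> is the integral of \<open>e\<close>. There
  \<open>y' = A y + g\<close> with one fixed linear map \<open>A\<close> (\<open>pid_map\<close>); an eigenvector of \<open>A\<close> for \<open>\<lambda>\<close> has the
  form \<open>(z, \<lambda> z, \<lambda>\<^sup>2 z)\<close> with \<open>(\<lambda>\<^sup>3 I + \<lambda>\<^sup>2 K\<^sub>D + \<lambda> K\<^sub>P + K\<^sub>I) z = 0\<close>, so every eigenvalue is a root of the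
  given polynomial and has negative real part (\<open>stable_spectrum_pid_map\<close>).

  A linear map with such a spectrum has a quadratic Lyapunov function (\<open>ex_lyapunov_form\<close>), and this
  function decays exponentially also when \<open>A\<close> is perturbed by a term \<open>g\<close> that is small
  relative to \<open>y\<close> (\<open>perturbed_linear_decay\<close>). As \<open>E\<close> vanishes at time 0, the initial value of \<open>y\<close>
  is bounded by that of \<open>(\<Delta>R, \<Omega>)\<close>.

  What remains is the symmetric part of \<open>Z\<close>, which \<open>y\<close> does not see. In the linear system \<open>g = 0\<close> and
  \<open>Sym Z\<close> obeys the decoupled equation \<open>S' = -2 k\<^sub>e S\<close>. In the rigid body system \<open>I + Z\<close> is orthogonal,
  whence \<open>Sym Z = - Z\<^sup>T Z / 2\<close> is of second order: near the identity \<open>Z\<close> is controlled by \<open>e\<close> alone, and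
  \<open>g\<close>, which is bilinear in \<open>Z\<close> and \<open>\<Omega>\<close>, is small relative to \<open>y\<close> as long as \<open>Z\<close> stays small. The decay of
  \<open>y\<close> in turn keeps \<open>Z\<close> small, so a continuity argument (\<open>continuation\<close>) closes the loop.
\<close>

section \<open>Annihilating products of linear factors\<close>

text \<open>
  Complex eigenvalues of a real map on \<open>'a\<close> are treated on \<open>'a \<times> 'a\<close>, the pair \<open>(u, v)\<close> standing for
  \<open>u + i v\<close>. Only the real vector space and inner product structure of the product is used, so that the
  results descend to \<open>'a\<close> along \<open>u \<mapsto> (u, 0)\<close>.
\<close>

definition cmul :: "complex \<Rightarrow> 'a \<times> 'a \<Rightarrow> 'a \<times> 'a::real_vector" where
  "cmul c w = (Re c *\<^sub>R fst w - Im c *\<^sub>R snd w, Im c *\<^sub>R fst w + Re c *\<^sub>R snd w)"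

definition cplx :: "('a \<Rightarrow> 'a) \<Rightarrow> 'a \<times> 'a \<Rightarrow> 'a \<times> 'a" where
  "cplx A w = (A (fst w), A (snd w))"

definition cshift :: "('a \<Rightarrow> 'a) \<Rightarrow> complex \<Rightarrow> 'a \<times> 'a \<Rightarrow> 'a \<times> 'a::real_vector" where
  "cshift A c w = cplx A w - cmul c w"

fun cprod :: "('a \<Rightarrow> 'a) \<Rightarrow> complex list \<Rightarrow> 'a \<times> 'a \<Rightarrow> 'a \<times> 'a::real_vector" where
  "cprod A [] w = w"
| "cprod A (c # cs) w = cprod A cs (cshift A c w)"

lemma linear_cmul: "linear (cmul c)"
  by (rule linearI) (auto simp: cmul_def algebra_simps)

lemma cmul_add_left: "cmul (c + d) w = cmul c w + cmul d w"
  by (auto simp: cmul_def algebra_simps)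

lemma cmul_mult: "cmul (c * d) w = cmul c (cmul d w)"
  by (auto simp: cmul_def algebra_simps)

lemma cmul_0 [simp]: "cmul 0 w = 0"
  by (simp add: cmul_def zero_prod_def)

lemma cmul_1 [simp]: "cmul 1 w = w"
  by (auto simp: cmul_def)

lemma cmul_of_real: "cmul (of_real r) w = r *\<^sub>R w"
  by (auto simp: cmul_def prod_eq_iff)

lemma cmul_eq_0_iff: "cmul c w = 0 \<longleftrightarrow> c = 0 \<or> w = 0"
proof
  assume h: "cmul c w = 0"
  show "c = 0 \<or> w = 0"
  proof (rule disjCI)
    assume "w \<noteq> 0"
    have "cmul (inverse c * c) w = 0"
      unfolding cmul_mult h by (rule linear_0[OF linear_cmul])
    then show "c = 0" using \<open>w \<noteq> 0\<close> by (cases "c = 0") auto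
  qed
qed (erule disjE; simp add: linear_0[OF linear_cmul])

lemma cmul_minus_left: "cmul (- c) w = - cmul c w"
  by (simp add: cmul_def)

text \<open>The Euclidean inner product on pairs is the real part of the Hermitian one, and this is why the sign of
  the real part of an eigenvalue decides whether \<open>\<bar>w\<bar>\<^sup>2\<close> decreases.\<close>

lemma inner_cmul: "inner w (cmul c w) = Re c * (norm w)\<^sup>2"
  for w :: "'a::real_inner \<times> 'a"
  by (cases w) (simp add: cmul_def power2_norm_eq_inner inner_commute algebra_simps)

context
  fixes A :: "'a::real_vector \<Rightarrow> 'a"
  assumes A: "linear A"
begin

lemma linear_cplx: "linear (cplx A)"
  by (rule linearI) (auto simp: cplx_def linear_add[OF A] linear_scale[OF A])

lemma cplx_cmul: "cplx A (cmul c w) = cmul c (cplx A w)"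
  by (auto simp: cplx_def cmul_def linear_add[OF A] linear_scale[OF A] linear_diff[OF A])

lemma linear_cshift: "linear (cshift A c)"
  unfolding cshift_def using linear_cplx linear_cmul
  by (auto intro: linear_compose_sub)

lemma cshift_cplx: "cshift A c (cplx A w) = cplx A (cshift A c w)"
  by (simp add: cshift_def cplx_cmul linear_diff[OF linear_cplx])

lemma cshift_cmul: "cshift A c (cmul d w) = cmul d (cshift A c w)"
  by (simp add: cshift_def cplx_cmul linear_diff[OF linear_cmul] mult.commute flip: cmul_mult)

lemma cshift_cshift: "cshift A c (cshift A d w) = cshift A d (cshift A c w)"
  by (simp add: cshift_def[of A d] linear_diff[OF linear_cshift] cshift_cplx cshift_cmul)

lemma linear_cprod: "linear (cprod A cs)"
proof (induction cs)
  case Nil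
  have "cprod A [] = id" by auto
  then show ?case by (metis linear_id)
next
  case (Cons c cs)
  have "cprod A (c # cs) = cprod A cs \<circ> cshift A c" by auto
  then show ?case using Cons linear_cshift linear_compose by metis
qed

lemma cprod_cshift: "cprod A cs (cshift A c w) = cshift A c (cprod A cs w)"
  by (induction cs arbitrary: w) (simp_all add: cshift_cshift[of _ c])

lemma cprod_append: "cprod A (cs @ ds) w = cprod A ds (cprod A cs w)"
  by (induction cs arbitrary: w) simp_all

lemma cprod_cprod: "cprod A cs (cprod A ds w) = cprod A ds (cprod A cs w)"
  by (induction cs arbitrary: w) (simp_all add: cprod_cshift)

text \<open>A factor with trivial kernel can be cancelled since the factors commute. This discards the linear factors
  of an annihilating polynomial that do not belong to eigenvalues.\<close>

lemma cprod_filter: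
  assumes "\<And>c w. \<not> P c \<Longrightarrow> cshift A c w = 0 \<Longrightarrow> w = 0" and "cprod A cs w = 0"
  shows "cprod A (filter P cs) w = 0"
  using assms(2)
proof (induction cs arbitrary: w)
  case (Cons c cs)
  have "P c" if "cprod A (filter P cs) w \<noteq> 0"
  proof (rule ccontr)
    assume "\<not> P c"
    moreover have "cshift A c (cprod A (filter P cs) w) = 0"
      using Cons.IH[of "cshift A c w"] Cons.prems by (simp add: cprod_cshift)
    ultimately show False using assms(1) that by blast
  qed
  with Cons.IH[of "cshift A c w"] Cons.prems show ?case by auto
qed auto

text \<open>The value at \<open>w\<close> of a polynomial in the complexified map. The summation bound is a parameter, to be
  any bound of the degree, which avoids truncation when factors are split off.\<close>

definition poly_act :: "nat \<Rightarrow> complex poly \<Rightarrow> 'a \<times> 'a \<Rightarrow> 'a \<times> 'a" where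
  "poly_act n p w = (\<Sum>i\<le>n. cmul (coeff p i) ((cplx A ^^ i) w))"

lemma poly_act_linear_factor:
  assumes "degree q \<le> n"
  shows "poly_act (Suc n) ([:- c, 1:] * q) w = poly_act n q (cshift A c w)"
proof -
  have pow: "linear (cplx A ^^ i)" for i
    by (induction i)
       (use linear_cplx in \<open>simp_all add: linear_compose linear_id del: o_apply\<close>,
        simp add: id_def[symmetric] linear_id)
  have pc: "(cplx A ^^ i) (cmul c w) = cmul c ((cplx A ^^ i) w)" for i
    by (induction i) (auto simp: cplx_cmul)
  have "poly_act (Suc n) ([:- c, 1:] * q) w
      = (\<Sum>i\<le>Suc n. cmul (coeff (pCons 0 q) i) ((cplx A ^^ i) w))
        + (\<Sum>i\<le>Suc n. cmul (- c * coeff q i) ((cplx A ^^ i) w))"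
    unfolding poly_act_def sum.distrib[symmetric] cmul_add_left[symmetric]
    by (intro sum.cong refl) simp
  also have "(\<Sum>i\<le>Suc n. cmul (coeff (pCons 0 q) i) ((cplx A ^^ i) w))
      = (\<Sum>i\<le>n. cmul (coeff q i) ((cplx A ^^ i) (cplx A w)))"
    by (subst sum.atMost_Suc_shift) (simp add: funpow_swap1)
  also have "(\<Sum>i\<le>Suc n. cmul (- c * coeff q i) ((cplx A ^^ i) w))
      = (\<Sum>i\<le>n. cmul (- c * coeff q i) ((cplx A ^^ i) w))"
    using assms by (simp add: coeff_eq_0)
  also have "\<dots> = - (\<Sum>i\<le>n. cmul (coeff q i) ((cplx A ^^ i) (cmul c w)))"
    unfolding sum_negf[symmetric]
    by (intro sum.cong refl)
       (simp add: pc mult.commute[of c] cmul_minus_left flip: cmul_mult)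
  finally show ?thesis
    by (simp add: poly_act_def cshift_def linear_diff[OF pow] linear_diff[OF linear_cmul] sum_subtractf)
qed

text \<open>The fundamental theorem of algebra splits the polynomial into linear factors.\<close>

lemma cprod_of_poly_act:
  assumes "poly_act (degree p) p w = 0" "p \<noteq> 0"
  shows "\<exists>cs. cprod A cs w = 0"
  using assms
proof (induction "degree p" arbitrary: p w)
  case 0
  then obtain c where p: "p = [:c:]" "c \<noteq> 0"
    using degree_0_id[of p] by (metis pCons_0_0)
  with 0 have "w = 0" by (simp add: poly_act_def cmul_eq_0_iff)
  then show ?case by (intro exI[of _ "[]"]) auto
next
  case (Suc n)
  have "\<not> constant (poly p)"
    using Suc(2) constant_degree[of p] by simp
  then obtain c where "poly p c = 0"
    using fundamental_theorem_of_algebra by blast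
  then obtain q where q: "p = [:- c, 1:] * q"
    by (auto simp: poly_eq_0_iff_dvd)
  with Suc have "q \<noteq> 0" by auto
  then have deg: "degree p = Suc (degree q)" unfolding q
    by (subst degree_mult_eq) auto
  with Suc(3) have "poly_act (degree q) q (cshift A c w) = 0"
    using poly_act_linear_factor[of q "degree q" c w] q by simp
  then obtain cs where "cprod A cs (cshift A c w) = 0"
    using Suc.hyps(1)[of q] Suc.hyps(2) deg \<open>q \<noteq> 0\<close> by (metis Suc_inject)
  then show ?case by (intro exI[of _ "c # cs"]) auto
qed


text \<open>In finite dimension, expressed here by the bound \<open>N\<close> on independent sets, some iterate of \<open>w\<close> is a
  real combination of the earlier ones.\<close>

lemma ex_poly_act_eq_0:
  fixes w :: "'a \<times> 'a"
  assumes fin: "\<And>S :: ('a \<times> 'a) set. independent S \<Longrightarrow> finite S \<and> card S \<le> N"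
  shows "\<exists>p. p \<noteq> 0 \<and> poly_act (degree p) p w = 0"
proof -
  define f where "f i = (cplx A ^^ i) w" for i
  have "\<exists>k. f k \<in> span (f ` {..<k})"
  proof (rule ccontr)
    assume "\<not> ?thesis"
    then have n: "f k \<notin> span (f ` {..<k})" for k by simp
    have "independent (f ` {..<k}) \<and> card (f ` {..<k}) = k" for k
    proof (induction k)
      case (Suc k)
      have "f k \<notin> f ` {..<k}" using n[of k] span_base[of "f k"] by metis
      with Suc n[of k] show ?case by (simp add: lessThan_Suc independent_insert card_insert_if)
    qed (simp add: independent_empty)
    from fin[of "f ` {..<Suc N}"] this[of "Suc N"] show False by simp
  qed
  then obtain k where k: "f k \<in> span (f ` {..<k})" by blast
  have "\<exists>a. x = (\<Sum>i<j. a i *\<^sub>R f i)" if "x \<in> span (f ` {..<j})" for x j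
    using that
  proof (induction j arbitrary: x)
    case (Suc j)
    then obtain r where "x - r *\<^sub>R f j \<in> span (f ` {..<j})"
      unfolding lessThan_Suc image_insert span_breakdown_eq by metis
    with Suc.IH obtain a where a: "x - r *\<^sub>R f j = (\<Sum>i<j. a i *\<^sub>R f i)" by blast
    have "(\<Sum>i<Suc j. (a(j := r)) i *\<^sub>R f i) = (\<Sum>i<j. a i *\<^sub>R f i) + r *\<^sub>R f j"
      unfolding sum.lessThan_Suc by (intro arg_cong2[of _ _ _ _ "(+)"] sum.cong) auto
    with a have "x = (\<Sum>i<Suc j. (a(j := r)) i *\<^sub>R f i)" by (metis diff_add_cancel)
    then show ?case by blast
  qed simp
  with k obtain a where a: "f k = (\<Sum>i<k. a i *\<^sub>R f i)" by blast
  define p where "p = monom 1 k - (\<Sum>i<k. monom (complex_of_real (a i)) i)"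
  have cp: "coeff p i = (if i = k then 1 else if i < k then - complex_of_real (a i) else 0)" for i
    by (auto simp: p_def coeff_sum)
  have "degree p = k"
    by (intro antisym degree_le le_degree) (auto simp: cp)
  then have "poly_act (degree p) p w = (\<Sum>i<k. cmul (- complex_of_real (a i)) (f i)) + f k"
    unfolding poly_act_def f_def lessThan_Suc_atMost[symmetric] sum.lessThan_Suc
    by (intro arg_cong2[of _ _ _ _ "(+)"] sum.cong) (auto simp: cp)
  then have "poly_act (degree p) p w = 0"
    using a by (simp add: cmul_minus_left cmul_of_real sum_negf)
  moreover have "p \<noteq> 0" using cp[of k] by auto
  ultimately show ?thesis by blast
qed

end

text \<open>All eigenvalues, with their eigenvectors in the complexification, lie in the open left half plane.\<close>

definition stable_spectrum :: "('a::real_vector \<Rightarrow> 'a) \<Rightarrow> bool" where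
  "stable_spectrum A \<longleftrightarrow> (\<forall>c w. cshift A c w = 0 \<longrightarrow> w \<noteq> 0 \<longrightarrow> Re c < 0)"

text \<open>The lists that annihilate the basis vectors are concatenated, and then the factors that are not
  eigenvalues are dropped.\<close>

lemma ex_cprod_eq_0:
  fixes A :: "'a::euclidean_space \<Rightarrow> 'a"
  assumes A: "linear A"
    and hurw: "stable_spectrum A"
  shows "\<exists>cs. (\<forall>c\<in>set cs. Re c < 0) \<and> (\<forall>w. cprod A cs w = 0)"
proof -
  have one: "\<exists>cs. cprod A cs w = 0" for w
    using ex_poly_act_eq_0[OF A, of "DIM('a \<times> 'a)" w] cprod_of_poly_act[OF A] independent_bound by blast
  have "\<exists>cs. \<forall>w\<in>S. cprod A cs w = 0" if "finite S" for S
    using that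
  proof (induction S rule: finite_induct)
    case (insert w S)
    then obtain cs ds where "\<forall>w\<in>S. cprod A cs w = 0" "cprod A ds w = 0"
      using one by blast
    then have "\<forall>v\<in>insert w S. cprod A (cs @ ds) v = 0"
      using linear_0[OF linear_cprod[OF A]]
      by (metis cprod_append[OF A] cprod_cprod[OF A] insert_iff)
    then show ?case by blast
  qed auto
  then obtain cs where cs: "\<forall>w\<in>Basis. cprod A cs w = 0"
    using finite_Basis by blast
  have "cprod A cs = (\<lambda>_. 0)"
    by (rule linear_eq_on_span[of _ _ Basis, THEN ext]) 
       (use cs in \<open>auto simp: linear_cprod[OF A] linear_zero\<close>)
  then have "cprod A (filter (\<lambda>c. Re c < 0) cs) w = 0" for w
    by (intro cprod_filter[OF A]) (use hurw in \<open>auto simp: stable_spectrum_def\<close>)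
  then show ?thesis by (intro exI[of _ "filter (\<lambda>c. Re c < 0) cs"]) auto
qed

section \<open>Quadratic Lyapunov functions and exponential decay\<close>

lemma bounded_bilinear_add_scaled:
  fixes B C :: "'a::real_normed_vector \<Rightarrow> 'b::real_normed_vector \<Rightarrow> real"
  assumes B: "bounded_bilinear B" and C: "bounded_bilinear C"
  shows "bounded_bilinear (\<lambda>x y. B x y + d * C x y)"
proof
  obtain K L where K: "\<And>x y. norm (B x y) \<le> norm x * norm y * K"
    and L: "\<And>x y. norm (C x y) \<le> norm x * norm y * L"
    using bounded_bilinear.bounded[OF B] bounded_bilinear.bounded[OF C] by metis
  show "\<exists>K. \<forall>x y. norm (B x y + d * C x y) \<le> norm x * norm y * K"
  proof (intro exI allI)
    fix x y
    have "norm (B x y + d * C x y) \<le> norm (B x y) + \<bar>d\<bar> * norm (C x y)"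
      by (rule norm_triangle_le) (simp add: abs_mult)
    also have "\<dots> \<le> norm x * norm y * K + \<bar>d\<bar> * (norm x * norm y * L)"
      by (intro add_mono mult_left_mono K L) auto
    finally show "norm (B x y + d * C x y) \<le> norm x * norm y * (K + \<bar>d\<bar> * L)"
      by (simp add: algebra_simps)
  qed
next
  interpret B: bounded_bilinear B by (rule B)
  interpret C: bounded_bilinear C by (rule C)
  fix a a' b b' r
  show "B (a + a') b + d * C (a + a') b = B a b + d * C a b + (B a' b + d * C a' b)"
    by (simp add: B.add_left C.add_left distrib_left)
  show "B a (b + b') + d * C a (b + b') = B a b + d * C a b + (B a b' + d * C a b')"
    by (simp add: B.add_right C.add_right distrib_left)
  show "B (r *\<^sub>R a) b + d * C (r *\<^sub>R a) b = r *\<^sub>R (B a b + d * C a b)"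
    by (simp add: B.scaleR_left C.scaleR_left distrib_left)
  show "B a (r *\<^sub>R b) + d * C a (r *\<^sub>R b) = r *\<^sub>R (B a b + d * C a b)"
    by (simp add: B.scaleR_right C.scaleR_right distrib_left)
qed

text \<open>With \<open>w\<^sub>0 = w\<close> and \<open>w\<^sub>k\<^sub>+\<^sub>1 = (A - c\<^sub>k) w\<^sub>k\<close>, the equation \<open>w' = A w\<close> becomes the triangular system
  \<open>w\<^sub>k' = c\<^sub>k w\<^sub>k + w\<^sub>k\<^sub>+\<^sub>1\<close>, which ends in zero. A sum of the \<open>\<bar>w\<^sub>k\<bar>\<^sup>2\<close> with suitable weights is therefore a
  Lyapunov function: the coupling to \<open>w\<^sub>k\<^sub>+\<^sub>1\<close> is absorbed by giving the later terms a large enough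
  weight.\<close>

lemma lyapunov_chain:
  fixes A :: "'a::euclidean_space \<Rightarrow> 'a"
  assumes A: "linear A" and "\<forall>c\<in>set cs. Re c < 0"
  shows "\<exists>B a. bounded_bilinear B \<and> (\<forall>v w. B v w = B w v) \<and> a > 0 \<and>
    (\<forall>w. cprod A cs w = 0 \<longrightarrow> (norm w)\<^sup>2 \<le> B w w \<and> B w (cplx A w) \<le> - a * B w w)"
  using assms(2)
proof (induction cs)
  case Nil
  show ?case
    by (rule exI[of _ inner], rule exI[of _ 1])
       (simp add: bounded_bilinear_inner inner_commute cplx_def linear_0[OF A])
next
  case (Cons c cs)
  let ?T = "cshift A c" and ?r = "- Re c"
  from Cons obtain B a where B: "bounded_bilinear B" "\<And>v w. B v w = B w v" and a: "a > 0"
    and ge: "\<And>w. cprod A cs w = 0 \<Longrightarrow> (norm w)\<^sup>2 \<le> B w w"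
    and le: "\<And>w. cprod A cs w = 0 \<Longrightarrow> B w (cplx A w) \<le> - a * B w w"
    by auto
  have r: "?r > 0" using Cons by simp
  \<comment> \<open>Half of \<open>d * a\<close>, the decay of the later terms, has to absorb \<open>1 / (2 * ?r)\<close> from Young's
    inequality.\<close>
  define d where "d = 1 / (?r * a)"
  define a' where "a' = min (?r / 2) (a / 2)"
  define B' where "B' v w = v \<bullet> w + d * B (?T v) (?T w)" for v w
  have T: "bounded_linear ?T"
    using linear_cshift[OF A] linear_conv_bounded_linear by blast
  have d: "d > 0" "d * a = 1 / ?r"
    unfolding d_def by (intro divide_pos_pos mult_pos_pos r a) (use a in simp_all)
  have "bounded_bilinear B'"
    unfolding B'_def
    by (intro bounded_bilinear_add_scaled bounded_bilinear_inner
        bounded_bilinear.comp[OF B(1)] T)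
  moreover have "B' v w = B' w v" for v w
    by (simp add: B'_def B(2)[of "?T v"] inner_commute)
  moreover have "a' > 0" using r a by (simp add: a'_def)
  moreover have "(norm w)\<^sup>2 \<le> B' w w \<and> B' w (cplx A w) \<le> - a' * B' w w"
    if "cprod A (c # cs) w = 0" for w
  proof -
    let ?b = "B (?T w) (?T w)" and ?n = "(norm w)\<^sup>2"
    from that have *: "cprod A cs (?T w) = 0" by simp
    have b: "(norm (?T w))\<^sup>2 \<le> ?b" using ge * by blast
    then have b0: "?b \<ge> 0" using zero_le_power2 order_trans by blast
    have w: "cplx A w = cmul c w + ?T w" by (simp add: cshift_def)
    have "B' w (cplx A w) = - ?r * ?n + w \<bullet> ?T w + d * B (?T w) (cplx A (?T w))"
      unfolding B'_def cshift_cplx[OF A] by (subst w) (simp add: inner_add_right inner_cmul)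
    also have "w \<bullet> ?T w \<le> ?r / 2 * ?n + 1 / (2 * ?r) * (norm (?T w))\<^sup>2"
    proof -
      have "w \<bullet> ?T w \<le> norm w * norm (?T w)" by (rule norm_cauchy_schwarz)
      moreover have "0 \<le> (?r * norm w - norm (?T w))\<^sup>2 / (2 * ?r)"
        by (intro divide_nonneg_pos) (use r in simp_all)
      moreover have "(?r * norm w - norm (?T w))\<^sup>2 / (2 * ?r)
          = ?r / 2 * ?n + 1 / (2 * ?r) * (norm (?T w))\<^sup>2 - norm w * norm (?T w)"
        using r by (simp add: power2_eq_square field_simps)
      ultimately show ?thesis by linarith
    qed
    also have "1 / (2 * ?r) * (norm (?T w))\<^sup>2 \<le> 1 / (2 * ?r) * ?b"
      using b r by (intro mult_left_mono) auto
    also have "d * B (?T w) (cplx A (?T w)) \<le> d * (- a * ?b)"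
      using le * d by (intro mult_left_mono) auto
    also have "d * (- a * ?b) = - (1 / ?r) * ?b" using d by (simp flip: mult.assoc)
    also have "- ?r * ?n + (?r / 2 * ?n + 1 / (2 * ?r) * ?b) + - (1 / ?r) * ?b
        = - (?r / 2) * ?n - (d * (a / 2)) * ?b"
    proof -
      define q where "q = 1 / (2 * ?r)"
      have "1 / ?r = 2 * q" "d * (a / 2) = q" using d by (simp_all add: q_def)
      then show ?thesis unfolding q_def[symmetric] by (simp add: algebra_simps)
    qed
    also have "\<dots> \<le> - a' * ?n - (d * a') * ?b"
    proof -
      have "a' * ?n \<le> ?r / 2 * ?n" "d * a' * ?b \<le> d * (a / 2) * ?b"
        by (intro mult_right_mono mult_left_mono; use d b0 in \<open>simp add: a'_def\<close>)+
      then show ?thesis by linarith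
    qed
    finally have "B' w (cplx A w) \<le> - a' * B' w w"
      by (simp add: B'_def algebra_simps power2_norm_eq_inner)
    moreover have "?n \<le> B' w w" using d b0 by (simp add: B'_def power2_norm_eq_inner)
    ultimately show ?thesis by blast
  qed
  ultimately show ?case by blast
qed

lemma ex_lyapunov_form:
  fixes A :: "'a::euclidean_space \<Rightarrow> 'a"
  assumes A: "linear A" and hurw: "stable_spectrum A"
  obtains B a where "bounded_bilinear B" "\<And>x y. B x y = B y x" "a > 0"
    "\<And>x. (norm x)\<^sup>2 \<le> B x x" "\<And>x. B x (A x) \<le> - a * B x x"
proof -
  from ex_cprod_eq_0[OF A hurw] obtain cs
    where cs: "\<forall>c\<in>set cs. Re c < 0" "\<And>w. cprod A cs w = 0" by blast
  from lyapunov_chain[OF A cs(1)] cs(2) obtain B a where B: "bounded_bilinear B"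
    "\<And>v w. B v w = B w v" "a > 0" "\<And>w. (norm w)\<^sup>2 \<le> B w w" "\<And>w. B w (cplx A w) \<le> - a * B w w"
    by blast
  have emb: "bounded_linear (\<lambda>x::'a. (x, 0::'a))"
    by (intro bounded_linear_Pair bounded_linear_ident bounded_linear_zero)
  show ?thesis
  proof
    show "bounded_bilinear (\<lambda>x y. B (x, 0) (y, 0))"
      by (rule bounded_bilinear.comp[OF B(1) emb emb])
    show "B (x, 0) (A x, 0) \<le> - a * B (x, 0) (x, 0)" for x
      using B(5)[of "(x, 0)"] by (simp add: cplx_def linear_0[OF A])
    show "(norm x)\<^sup>2 \<le> B (x, 0) (x, 0)" for x
      using B(4)[of "(x, 0)"] by simp
    show "B (x, 0) (y, 0) = B (y, 0) (x, 0)" for x y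
      by (rule B(2))
  qed (rule B(3))
qed

lemma exp_decay_of_deriv_le:
  fixes V :: "real \<Rightarrow> real"
  assumes "T \<ge> 0"
    and V: "\<And>t. 0 \<le> t \<Longrightarrow> t \<le> T \<Longrightarrow> (V has_real_derivative V' t) (at t within {0..})"
    and le: "\<And>t. 0 \<le> t \<Longrightarrow> t \<le> T \<Longrightarrow> V' t \<le> - a * V t"
  shows "V T \<le> exp (- a * T) * V 0"
proof -
  define W where "W t = exp (a * t) * V t" for t
  have W: "(W has_real_derivative exp (a * t) * (a * V t + V' t)) (at t within {0..})"
    if "0 \<le> t" "t \<le> T" for t
    unfolding W_def by (rule derivative_eq_intros V that refl | simp add: algebra_simps)+
  have "W T \<le> W 0"
  proof (rule DERIV_nonpos_imp_decreasing_open[OF \<open>T \<ge> 0\<close>])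
    fix t assume t: "0 < t" "t < T"
    then have "at t within {0..} = at t"
      by (intro at_within_interior) (simp add: interior_real_atLeast)
    with W[of t] t have "(W has_real_derivative exp (a * t) * (a * V t + V' t)) (at t)" by simp
    moreover have "exp (a * t) * (a * V t + V' t) \<le> 0"
      using le[of t] t by (intro mult_nonneg_nonpos) auto
    ultimately show "\<exists>y. DERIV W t :> y \<and> y \<le> 0" by blast
  next
    show "continuous_on {0..T} W"
      unfolding continuous_on_eq_continuous_within
    proof
      fix t assume "t \<in> {0..T}"
      then have "continuous (at t within {0..}) W"
        using W by (intro DERIV_continuous) auto
      then show "continuous (at t within {0..T}) W"
        by (rule continuous_within_subset) auto
    qed
  qed
  then show ?thesis by (simp add: W_def exp_minus field_simps)
qed

text \<open>The Lyapunov inequality for \<open>A\<close> leaves room for a relative perturbation. The horizon \<open>T\<close> is finite so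
  that the bound on \<open>g\<close> may itself be obtained by continuation in \<open>T\<close>.\<close>

lemma perturbed_linear_decay:
  fixes A :: "'a::euclidean_space \<Rightarrow> 'a"
  assumes A: "linear A" and hurw: "stable_spectrum A"
  obtains C c \<epsilon> where "C > 0" "c > 0" "\<epsilon> > 0"
    "\<And>(y :: real \<Rightarrow> 'a) g T. T \<ge> 0 \<Longrightarrow>
       (\<And>t. 0 \<le> t \<Longrightarrow> t \<le> T \<Longrightarrow> (y has_vector_derivative A (y t) + g t) (at t within {0..})) \<Longrightarrow>
       (\<And>t. 0 \<le> t \<Longrightarrow> t \<le> T \<Longrightarrow> norm (g t) \<le> \<epsilon> * norm (y t)) \<Longrightarrow>
       norm (y T) \<le> C * exp (- c * T) * norm (y 0)"
proof -
  obtain B a where B: "bounded_bilinear B" "\<And>x y. B x y = B y x" and a: "a > 0"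
    and ge: "\<And>x. (norm x)\<^sup>2 \<le> B x x" and le: "\<And>x. B x (A x) \<le> - a * B x x"
    using ex_lyapunov_form[OF A hurw] by blast
  obtain K where K: "K > 0" "\<And>x y. norm (B x y) \<le> norm x * norm y * K"
    using bounded_bilinear.pos_bounded[OF B(1)] by blast
  have "norm (y T) \<le> sqrt K * exp (- (a / 2) * T) * norm (y 0)"
    if T: "T \<ge> 0"
      and y: "\<And>t. 0 \<le> t \<Longrightarrow> t \<le> T \<Longrightarrow> (y has_vector_derivative A (y t) + g t) (at t within {0..})"
      and g: "\<And>t. 0 \<le> t \<Longrightarrow> t \<le> T \<Longrightarrow> norm (g t) \<le> a / (2 * K) * norm (y t)"
    for y g T
  proof -
    let ?V = "\<lambda>t. B (y t) (y t)"
    have V: "(?V has_real_derivative 2 * B (y t) (A (y t) + g t)) (at t within {0..})"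
      if "0 \<le> t" "t \<le> T" for t
      using bounded_bilinear.has_vector_derivative[OF B(1) y[OF that] y[OF that]]
      by (simp add: has_real_derivative_iff_has_vector_derivative B(2)[of _ "y t"])
    have "2 * B (y t) (A (y t) + g t) \<le> - a * ?V t" if "0 \<le> t" "t \<le> T" for t
    proof -
      have "B (y t) (g t) \<le> norm (y t) * norm (g t) * K"
        using K(2)[of "y t" "g t"] by (simp add: abs_le_iff)
      also have "\<dots> \<le> norm (y t) * (a / (2 * K) * norm (y t)) * K"
        using g[OF that] K(1) by (intro mult_right_mono mult_left_mono) auto
      also have "\<dots> = a / 2 * (norm (y t))\<^sup>2"
        using K(1) by (simp add: power2_eq_square)
      also have "\<dots> \<le> a / 2 * ?V t" using ge a by (intro mult_left_mono) auto
      finally show ?thesis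
        using le[of "y t"] by (simp add: bounded_bilinear.add_right[OF B(1)])
    qed
    from exp_decay_of_deriv_le[OF T V this]
    have "(norm (y T))\<^sup>2 \<le> exp (- a * T) * B (y 0) (y 0)"
      using ge[of "y T"] by simp
    also have "B (y 0) (y 0) \<le> K * (norm (y 0))\<^sup>2"
      using K(2)[of "y 0" "y 0"] by (simp add: abs_le_iff power2_eq_square mult.commute)
    also have "exp (- a * T) * (K * (norm (y 0))\<^sup>2) = (sqrt K * exp (- (a / 2) * T) * norm (y 0))\<^sup>2"
      using K(1) by (simp add: power_mult_distrib flip: exp_double)
    finally show ?thesis
      by (rule power2_le_imp_le) (use K in auto)
  qed
  then show ?thesis
    using that[of "sqrt K" "a / 2" "a / (2 * K)"] a K(1) by fastforce
qed



section \<open>Closed-loop spectrum\<close>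

text \<open>The closed loop without perturbation, on triples (integral of the error, error, angular velocity).\<close>

definition pid_map :: "real^3^3 \<Rightarrow> real^3^3 \<Rightarrow> real^3^3 \<Rightarrow>
    (real^3) \<times> (real^3) \<times> (real^3) \<Rightarrow> (real^3) \<times> (real^3) \<times> (real^3)" where
  "pid_map K\<^sub>P K\<^sub>I K\<^sub>D = (\<lambda>(E, e, \<Omega>). (e, \<Omega>, - (K\<^sub>P *v e) - K\<^sub>D *v \<Omega> - K\<^sub>I *v E))"

lemma linear_pid_map: "linear (pid_map K\<^sub>P K\<^sub>I K\<^sub>D)"
  by (rule linearI)
     (auto simp: pid_map_def matrix_vector_right_distrib matrix_vector_mult_scaleR scaleR_diff_right)

abbreviation cpoly :: "real poly \<Rightarrow> complex \<Rightarrow> complex" where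
  "cpoly p \<equiv> poly (map_poly complex_of_real p)"

lemma cpoly_add: "cpoly (p + q) z = cpoly p z + cpoly q z"
proof -
  have "map_poly complex_of_real (p + q) = map_poly complex_of_real p + map_poly complex_of_real q"
    by (rule poly_eqI) (simp add: coeff_map_poly)
  then show ?thesis by simp
qed

lemma cpoly_minus: "cpoly (p - q) z = cpoly p z - cpoly q z"
proof -
  have "map_poly complex_of_real (p - q) = map_poly complex_of_real p - map_poly complex_of_real q"
    by (rule poly_eqI) (simp add: coeff_map_poly)
  then show ?thesis by simp
qed

lemma cpoly_mult: "cpoly (p * q) z = cpoly p z * cpoly q z"
  by (induction p)
     (simp_all add: cpoly_add map_poly_smult map_poly_pCons algebra_simps)

text \<open>Evaluation at a complex number is a ring homomorphism, so it commutes with the determinant.\<close>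

lemma cpoly_det:
  fixes P :: "real poly^3^3"
  shows "cpoly (det P) z = det (\<chi> i j. cpoly (P $ i $ j) z)"
  by (simp add: det_3 cpoly_add cpoly_minus cpoly_mult)

text \<open>The passage from the pair encoding of complex vectors to honest ones, over which a singular matrix
  has determinant zero.\<close>

definition cvec :: "real^'n \<Rightarrow> real^'n \<Rightarrow> complex^'n" where
  "cvec u v = (\<chi> i. Complex (u $ i) (v $ i))"

lemma cvec_eq_0_iff: "cvec u v = 0 \<longleftrightarrow> u = 0 \<and> v = 0"
  by (auto simp: cvec_def vec_eq_iff complex_eq_iff)

lemma cvec_mult: "cvec (a *\<^sub>R u - b *\<^sub>R v) (b *\<^sub>R u + a *\<^sub>R v) $ i = Complex a b * cvec u v $ i"
  by (simp add: cvec_def complex_eq_iff)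

lemma cvec_matrix: "cvec (K *v u) (K *v v) $ i = (\<Sum>j\<in>UNIV. of_real (K $ i $ j) * cvec u v $ j)"
  by (simp add: cvec_def complex_eq_iff matrix_vector_mult_def)

lemma stable_spectrum_pid_map:
  assumes "hurwitz (pid_poly K\<^sub>P K\<^sub>I K\<^sub>D)"
  shows "stable_spectrum (pid_map K\<^sub>P K\<^sub>I K\<^sub>D)"
  unfolding stable_spectrum_def
proof (intro allI impI)
  fix c and w :: "((real^3) \<times> (real^3) \<times> (real^3)) \<times> ((real^3) \<times> (real^3) \<times> (real^3))"
  assume eig: "cshift (pid_map K\<^sub>P K\<^sub>I K\<^sub>D) c w = 0" and "w \<noteq> 0"
  obtain E e \<Omega> E' e' \<Omega>' where w: "w = ((E, e, \<Omega>), (E', e', \<Omega>'))" by (metis prod.exhaust)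
  let ?M = "\<chi> i j. cpoly [:K\<^sub>I$i$j, K\<^sub>P$i$j, K\<^sub>D$i$j, (mat 1 :: real^3^3)$i$j:] c"
  have eqs: "e = Re c *\<^sub>R E - Im c *\<^sub>R E'" "e' = Im c *\<^sub>R E + Re c *\<^sub>R E'"
    "\<Omega> = Re c *\<^sub>R e - Im c *\<^sub>R e'" "\<Omega>' = Im c *\<^sub>R e + Re c *\<^sub>R e'"
    "- (K\<^sub>P *v e) - K\<^sub>D *v \<Omega> - K\<^sub>I *v E = Re c *\<^sub>R \<Omega> - Im c *\<^sub>R \<Omega>'"
    "- (K\<^sub>P *v e') - K\<^sub>D *v \<Omega>' - K\<^sub>I *v E' = Im c *\<^sub>R \<Omega> + Re c *\<^sub>R \<Omega>'"
    using eig by (auto simp: cshift_def cplx_def cmul_def pid_map_def w zero_prod_def)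
  have ce: "cvec e e' $ i = c * cvec E E' $ i" for i
    using eqs(1,2) cvec_mult[of "Re c" E "Im c" E' i] by simp
  have cO: "cvec \<Omega> \<Omega>' $ i = c\<^sup>2 * cvec E E' $ i" for i
    using eqs(3,4) cvec_mult[of "Re c" e "Im c" e' i] ce by (simp add: power2_eq_square)
  have last: "- cvec (K\<^sub>P *v e) (K\<^sub>P *v e') $ i - cvec (K\<^sub>D *v \<Omega>) (K\<^sub>D *v \<Omega>') $ i
      - cvec (K\<^sub>I *v E) (K\<^sub>I *v E') $ i = c * cvec \<Omega> \<Omega>' $ i" for i
  proof -
    have "- cvec (K\<^sub>P *v e) (K\<^sub>P *v e') $ i - cvec (K\<^sub>D *v \<Omega>) (K\<^sub>D *v \<Omega>') $ i
        - cvec (K\<^sub>I *v E) (K\<^sub>I *v E') $ i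
      = cvec (- (K\<^sub>P *v e) - K\<^sub>D *v \<Omega> - K\<^sub>I *v E) (- (K\<^sub>P *v e') - K\<^sub>D *v \<Omega>' - K\<^sub>I *v E') $ i"
      by (simp add: cvec_def complex_eq_iff)
    then show ?thesis unfolding eqs(5,6) cvec_mult by simp
  qed
  have "(?M *v cvec E E') $ i = 0" for i
  proof -
    have "(?M *v cvec E E') $ i
      = (\<Sum>j\<in>UNIV. of_real (K\<^sub>I $ i $ j) * cvec E E' $ j)
      + (\<Sum>j\<in>UNIV. of_real (K\<^sub>P $ i $ j) * cvec e e' $ j)
      + (\<Sum>j\<in>UNIV. of_real (K\<^sub>D $ i $ j) * cvec \<Omega> \<Omega>' $ j)
      + (\<Sum>j\<in>UNIV. if i = j then c ^ 3 * cvec E E' $ j else 0)"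
      unfolding ce cO matrix_vector_mult_def sum.distrib[symmetric]
      by (simp, intro sum.cong refl)
         (simp add: map_poly_pCons mat_def algebra_simps power2_eq_square power3_eq_cube)
    also have "\<dots> = 0"
    proof -
      have "c ^ 3 * cvec E E' $ i = - cvec (K\<^sub>P *v e) (K\<^sub>P *v e') $ i
          - cvec (K\<^sub>D *v \<Omega>) (K\<^sub>D *v \<Omega>') $ i - cvec (K\<^sub>I *v E) (K\<^sub>I *v E') $ i"
        unfolding last cO by (simp add: power2_eq_square power3_eq_cube mult.assoc)
      then show ?thesis unfolding cvec_matrix[symmetric] by simp
    qed
    finally show ?thesis .
  qed
  then have M0: "?M *v cvec E E' = 0" by (simp add: vec_eq_iff)
  have "cvec E E' \<noteq> 0"
  proof
    assume "cvec E E' = 0"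
    then show False using \<open>w \<noteq> 0\<close> eqs(1-4) by (simp add: cvec_eq_0_iff w zero_prod_def)
  qed
  with M0 have "\<not> invertible ?M"
    using matrix_left_invertible_ker[of ?M] invertible_left_inverse[of ?M] by blast
  then have "det ?M = 0" using invertible_det_nz by blast
  then have "cpoly (pid_poly K\<^sub>P K\<^sub>I K\<^sub>D) c = 0"
    unfolding pid_poly_def cpoly_det by simp
  with assms show "Re c < 0" by (simp add: hurwitz_def)
qed

section \<open>Attitude error\<close>

text \<open>The extension of \<open>vee\<close> to all matrices that ignores the symmetric part. Being linear on the whole
  space, it replaces \<open>vee \<circ> Skew\<close>.\<close>

definition axial :: "real^3^3 \<Rightarrow> real^3" where
  "axial A = vector [(A$3$2 - A$2$3) / 2, (A$1$3 - A$3$1) / 2, (A$2$1 - A$1$2) / 2]"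

lemma matrix_add_rdistrib: "(A + B) ** C = A ** C + B ** C"
  for A B :: "'a::semiring_1^'n^'m" and C :: "'a^'k^'n"
  by (simp add: matrix_matrix_mult_def vec_eq_iff distrib_right sum.distrib)

lemma linear_axial: "linear axial"
  by (rule linearI) (auto simp: axial_def vec_eq_iff forall_3 field_simps)

lemma linear_hat: "linear hat"
  by (rule linearI) (auto simp: hat_def vec_eq_iff forall_3)

lemma linear_Sym: "linear (Sym :: real^'n^'n \<Rightarrow> _)"
  by (rule linearI) (auto simp: Sym_def vec_eq_iff transpose_def algebra_simps)

lemma axial_hat [simp]: "axial (hat v) = v"
  by (simp add: axial_def hat_def vec_eq_iff forall_3)

lemma hat_axial: "hat (axial A) = Skew A"
  by (simp add: axial_def hat_def Skew_def transpose_def vec_eq_iff forall_3 field_simps)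

lemma vee_Skew: "vee (Skew A) = axial A"
proof -
  have "inj hat" by (metis axial_hat injI)
  then show ?thesis unfolding vee_def hat_axial[symmetric] by (rule inv_f_f)
qed

lemma axial_Sym [simp]: "axial (Sym A) = 0"
  by (simp add: axial_def Sym_def transpose_def vec_eq_iff forall_3)

lemma Sym_hat [simp]: "Sym (hat v) = 0"
  by (simp add: Sym_def hat_def transpose_def vec_eq_iff forall_3)

lemma Sym_Sym [simp]: "Sym (Sym A) = Sym A"
  by (simp add: Sym_def transpose_def vec_eq_iff field_simps)

lemma Sym_add_hat_axial: "Sym A + hat (axial A) = A"
  by (simp add: hat_axial Sym_def Skew_def vec_eq_iff field_simps)

text \<open>On the rotation group the symmetric part of the error is of second order.\<close>

lemma Sym_of_orthogonal:
  assumes "orthogonal_matrix (mat 1 + Z)"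
  shows "Sym Z = - (1/2) *\<^sub>R (transpose Z ** Z)"
proof -
  have "transpose (mat 1 + Z) = mat 1 + transpose Z"
    by (simp add: transpose_def mat_def vec_eq_iff)
  then have "(mat 1 + transpose Z) ** (mat 1 + Z) = mat 1"
    using assms by (simp add: orthogonal_matrix_def)
  then have "Z + transpose Z = - (transpose Z ** Z)"
    by (simp add: matrix_add_rdistrib matrix_add_ldistrib eq_neg_iff_add_eq_0 algebra_simps)
  then show ?thesis by (simp add: Sym_def)
qed

section \<open>Closed loop\<close>

lemma integral_has_derivative_halfline:
  fixes f :: "real \<Rightarrow> 'a::banach"
  assumes "continuous_on {0..} f" "t \<ge> 0"
  shows "((\<lambda>u. integral {0..u} f) has_vector_derivative f t) (at t within {0..})"
proof -
  have "((\<lambda>u. integral {0..u} f) has_vector_derivative f t) (at t within {0..t + 1})"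
    by (rule integral_has_vector_derivative)
       (use assms in \<open>auto intro: continuous_on_subset\<close>)
  moreover have "at t within {0..t + 1} = at t within {0..}"
    by (rule at_within_nhd[of _ "{..<t + 1}"]) auto
  ultimately show ?thesis by simp
qed

text \<open>A strict bound cannot first be violated at a time up to which the weak bound holds.\<close>

lemma continuation:
  fixes f :: "real \<Rightarrow> real"
  assumes cont: "continuous_on {0..} f" and "f 0 < r" "T \<ge> 0"
    and step: "\<And>T. T \<ge> 0 \<Longrightarrow> (\<And>t. 0 \<le> t \<Longrightarrow> t \<le> T \<Longrightarrow> f t \<le> r) \<Longrightarrow> f T < r"
  shows "f T < r"
proof (rule ccontr)
  assume "\<not> f T < r"
  then have ne: "{t \<in> {0..T}. r \<le> f t} \<noteq> {}" using \<open>T \<ge> 0\<close> by auto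
  have cT: "continuous_on {0..T} f" using cont by (rule continuous_on_subset) auto
  have "compact {t \<in> {0..T}. r \<le> f t}"
    using continuous_closed_preimage[OF cT closed_atLeastAtMost closed_atLeast[of r]]
    by (auto simp: compact_eq_bounded_closed vimage_def Int_def intro: bounded_subset[of "{0..T}"])
  from compact_attains_inf[OF this ne] obtain s
    where s: "0 \<le> s" "s \<le> T" "r \<le> f s" and min: "\<And>t. 0 \<le> t \<Longrightarrow> t \<le> T \<Longrightarrow> r \<le> f t \<Longrightarrow> s \<le> t"
    by auto
  have "\<exists>t\<ge>0. t \<le> s \<and> f t = r"
    by (rule IVT') (use s \<open>f 0 < r\<close> cT in \<open>auto intro: continuous_on_subset\<close>)
  with min s have "f s = r" by force
  with min s have "f t \<le> r" if "0 \<le> t" "t \<le> s" for t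
    using that by (cases "t = s") force+
  with step[of s] s show False by auto
qed

lemma pid_state_derivative:
  fixes R\<^sub>0 :: "real^3^3" and X :: "real \<Rightarrow> real^3^3" and \<Omega> h :: "real \<Rightarrow> real^3"
  defines "e \<equiv> \<lambda>t. axial (transpose R\<^sub>0 ** X t)"
  defines "y \<equiv> \<lambda>t. (integral {0..t} e, e t, \<Omega> t)"
  assumes e: "\<And>t. t \<ge> 0 \<Longrightarrow> (e has_vector_derivative \<Omega> t + h t) (at t within {0..})"
    and \<Omega>: "\<And>t. t \<ge> 0 \<Longrightarrow>
      (\<Omega> has_vector_derivative pid_control R\<^sub>0 K\<^sub>P K\<^sub>I K\<^sub>D X \<Omega> t) (at t within {0..})"
    and t: "t \<ge> 0"
  shows "(y has_vector_derivative pid_map K\<^sub>P K\<^sub>I K\<^sub>D (y t) + (0, h t, 0)) (at t within {0..})"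
proof -
  have "continuous_on {0..} e"
    unfolding continuous_on_eq_continuous_within
    using e by (auto intro: has_vector_derivative_continuous)
  from integral_has_derivative_halfline[OF this t]
  have "(y has_vector_derivative (e t, \<Omega> t + h t, pid_control R\<^sub>0 K\<^sub>P K\<^sub>I K\<^sub>D X \<Omega> t)) (at t within {0..})"
    unfolding y_def by (intro has_vector_derivative_Pair e \<Omega> t)
  then show ?thesis
    by (simp add: y_def pid_map_def pid_control_def vee_Skew e_def)
qed

text \<open>Stating bounds as eventual in the constant lets a single constant serve several maps at once.\<close>

lemma linear_eventually_bounded:
  fixes f :: "'a::euclidean_space \<Rightarrow> 'b::real_normed_vector"
  assumes "linear f"
  shows "\<forall>\<^sub>F K in at_top. \<forall>x. norm (f x) \<le> K * norm x"
proof -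
  obtain B where "\<And>x. norm (f x) \<le> B * norm x" using linear_bounded[OF assms] by blast
  then show ?thesis
    by (intro eventually_at_top_linorderI[of B]) (meson mult_right_mono norm_ge_zero order_trans)
qed

lemma linear_matrix_mult_left: "linear (\<lambda>X :: real^'k^'n. A ** X)"
  by (rule linearI) (auto simp: matrix_add_ldistrib scalar_matrix_assoc matrix_scalar_ac)

lemma matrix_mult_eventually_bounded:
  "\<forall>\<^sub>F K in at_top. \<forall>(X :: real^'n^'m) (Y :: real^'k^'n). norm (X ** Y) \<le> K * norm X * norm Y"
proof -
  have "bilinear (\<lambda>(X :: real^'n^'m) (Y :: real^'k^'n). X ** Y)"
    unfolding bilinear_def
    by (auto intro!: linearI simp: matrix_add_ldistrib matrix_add_rdistrib scalar_matrix_assoc matrix_scalar_ac)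
  then obtain B where "\<And>(X :: real^'n^'m) (Y :: real^'k^'n). norm (X ** Y) \<le> B * norm X * norm Y"
    using bilinear_bounded by blast
  then show ?thesis
    by (intro eventually_at_top_linorderI[of B])
       (meson mult_right_mono norm_ge_zero order_trans)
qed

lemma ex_common_bound:
  fixes R\<^sub>0 :: "real^3^3"
  obtains K where "K \<ge> 1"
    "\<And>X :: real^3^3. norm (R\<^sub>0 ** X) \<le> K * norm X"
    "\<And>X :: real^3^3. norm (transpose R\<^sub>0 ** X) \<le> K * norm X"
    "\<And>X. norm (axial X) \<le> K * norm X"
    "\<And>v. norm (hat v) \<le> K * norm v"
    "\<And>X :: real^3^3. norm (Sym X) \<le> K * norm X"
    "\<And>X :: real^3^3. norm (transpose X) \<le> K * norm X"
    "\<And>(X :: real^3^3) (Y :: real^3^3). norm (X ** Y) \<le> K * norm X * norm Y"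
proof -
  have lt: "linear (transpose :: real^3^3 \<Rightarrow> real^3^3)"
    by (rule linearI) (auto simp: transpose_def vec_eq_iff)
  show ?thesis
    using eventually_happens[OF eventually_conj[OF eventually_ge_at_top[of "1::real"]
      eventually_conj[OF linear_eventually_bounded[OF linear_matrix_mult_left[of R\<^sub>0]]
      eventually_conj[OF linear_eventually_bounded[OF linear_matrix_mult_left[of "transpose R\<^sub>0"]]
      eventually_conj[OF linear_eventually_bounded[OF linear_axial]
      eventually_conj[OF linear_eventually_bounded[OF linear_hat]
      eventually_conj[OF linear_eventually_bounded[OF linear_Sym]
      eventually_conj[OF linear_eventually_bounded[OF lt] matrix_mult_eventually_bounded]]]]]]]]
      that by (metis trivial_limit_at_top_linorder)
qed

lemma orthogonal_cancel:
  assumes "orthogonal_matrix (R\<^sub>0 :: real^'n^'n)"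
  shows "transpose R\<^sub>0 ** (R\<^sub>0 ** X) = X" "R\<^sub>0 ** (transpose R\<^sub>0 ** X) = X"
  using assms by (auto simp: orthogonal_matrix_def matrix_mul_assoc)

lemma linear_has_vector_derivative:
  fixes f :: "'a::euclidean_space \<Rightarrow> 'b::real_normed_vector"
  assumes "linear f" "(g has_vector_derivative g') F"
  shows "((\<lambda>x. f (g x)) has_vector_derivative f g') F"
  using bounded_linear.has_vector_derivative[OF _ assms(2)] assms(1)
  by (simp add: linear_conv_bounded_linear)

lemma has_vector_derivative_fst_snd:
  assumes "(x has_vector_derivative (a, b)) F"
  shows "((\<lambda>t. fst (x t)) has_vector_derivative a) F" "((\<lambda>t. snd (x t)) has_vector_derivative b) F"
  using bounded_linear.has_vector_derivative[OF bounded_linear_fst assms]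
    bounded_linear.has_vector_derivative[OF bounded_linear_snd assms] by simp_all

lemma norm_fst: "norm (fst p) \<le> norm p"
  by (cases p) (simp add: norm_fst_le)

lemma norm_snd: "norm (snd p) \<le> norm p"
  by (cases p) (simp add: norm_snd_le)

lemma norm_le_fst_snd: "norm x \<le> norm (fst x) + norm (snd x)"
  by (metis norm_Pair_le prod.collapse)

lemma pid_control_0 [simp]: "pid_control R\<^sub>0 K\<^sub>P K\<^sub>I K\<^sub>D (\<lambda>_. 0) (\<lambda>_. 0) t = 0"
  by (simp add: pid_control_def vee_Skew linear_0[OF linear_axial] linear_0[OF linear_matrix_mult_left])

text \<open>The skew part of \<open>Z\<close> follows the unperturbed loop \<open>y' = A y\<close>, the symmetric part decouples and
  decays by itself.\<close>

lemma linear_exponentially_stable: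
  assumes R0: "orthogonal_matrix R\<^sub>0" and k: "k\<^sub>e > 0" and H: "hurwitz (pid_poly K\<^sub>P K\<^sub>I K\<^sub>D)"
  shows "exponentially_stabilizes UNIV (linear_system R\<^sub>0 k\<^sub>e)
           (\<lambda>x. pid_control R\<^sub>0 K\<^sub>P K\<^sub>I K\<^sub>D (\<lambda>t. fst (x t)) (\<lambda>t. snd (x t))) (0, 0)"
proof -
  obtain C c \<epsilon> where C: "C > 0" and c: "c > 0" and \<epsilon>: "\<epsilon> > 0" and decay:
    "\<And>(y :: real \<Rightarrow> (real^3) \<times> (real^3) \<times> (real^3)) g T. T \<ge> 0 \<Longrightarrow>
       (\<And>t. 0 \<le> t \<Longrightarrow> t \<le> T \<Longrightarrow>
         (y has_vector_derivative pid_map K\<^sub>P K\<^sub>I K\<^sub>D (y t) + g t) (at t within {0..})) \<Longrightarrow>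
       (\<And>t. 0 \<le> t \<Longrightarrow> t \<le> T \<Longrightarrow> norm (g t) \<le> \<epsilon> * norm (y t)) \<Longrightarrow>
       norm (y T) \<le> C * exp (- c * T) * norm (y 0)"
    using perturbed_linear_decay[OF linear_pid_map stable_spectrum_pid_map[OF H]] by metis
  obtain K where K: "K \<ge> 1"
    and K1: "\<And>X :: real^3^3. norm (R\<^sub>0 ** X) \<le> K * norm X"
    and K2: "\<And>X :: real^3^3. norm (transpose R\<^sub>0 ** X) \<le> K * norm X"
    and K3: "\<And>X. norm (axial X) \<le> K * norm X" and K4: "\<And>v. norm (hat v) \<le> K * norm v"
    and K5: "\<And>X :: real^3^3. norm (Sym X) \<le> K * norm X"
    using ex_common_bound[of R\<^sub>0] by metis
  \<comment> \<open>The symmetric part decays at rate \<open>2 * k\<^sub>e\<close>, the rest at rate \<open>c\<close>.\<close>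
  define m where "m = min c (2 * k\<^sub>e)"
  define C' where "C' = K * (K * K) + (K * K + 1) * (C * (K * K + 1))"
  have "norm (x t) \<le> C' * exp (- m * t) * norm (x 0)"
    if sol: "closed_loop_solution UNIV (linear_system R\<^sub>0 k\<^sub>e)
       (\<lambda>x. pid_control R\<^sub>0 K\<^sub>P K\<^sub>I K\<^sub>D (\<lambda>t. fst (x t)) (\<lambda>t. snd (x t))) x" and t: "t \<ge> 0" for x t
  proof -
    define X where "X t = fst (x t)" for t
    define \<Omega> where "\<Omega> t = snd (x t)" for t
    define Z where "Z t = transpose R\<^sub>0 ** X t" for t
    define e where "e t = axial (Z t)" for t
    define y where "y t = (integral {0..t} e, e t, \<Omega> t)" for t
    let ?u = "pid_control R\<^sub>0 K\<^sub>P K\<^sub>I K\<^sub>D X \<Omega>"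
    have x': "(x has_vector_derivative
        (R\<^sub>0 ** hat (\<Omega> t) - (2 * k\<^sub>e) *\<^sub>R (R\<^sub>0 ** Sym (Z t)), ?u t)) (at t within {0..})"
      if "t \<ge> 0" for t
      using sol that
      by (simp add: closed_loop_solution_def linear_system_def case_prod_beta X_def[abs_def] \<Omega>_def[abs_def] Z_def)
    have \<Omega>': "(\<Omega> has_vector_derivative ?u t) (at t within {0..})" if "t \<ge> 0" for t
      using has_vector_derivative_fst_snd(2)[OF x'[OF that]] by (simp add: \<Omega>_def[abs_def])
    have Z': "(Z has_vector_derivative hat (\<Omega> t) - (2 * k\<^sub>e) *\<^sub>R Sym (Z t)) (at t within {0..})"
      if "t \<ge> 0" for t
      using linear_has_vector_derivative[OF linear_matrix_mult_left[of "transpose R\<^sub>0"]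
          has_vector_derivative_fst_snd(1)[OF x'[OF that]]]
      by (simp add: Z_def[abs_def] X_def orthogonal_cancel[OF R0]
          linear_diff[OF linear_matrix_mult_left] linear_scale[OF linear_matrix_mult_left])
    have S': "((\<lambda>t. Sym (Z t)) has_vector_derivative - (2 * k\<^sub>e) *\<^sub>R Sym (Z t)) (at t within {0..})"
      if "t \<ge> 0" for t
      using linear_has_vector_derivative[OF linear_Sym Z'[OF that]]
      by (simp add: linear_diff[OF linear_Sym] linear_scale[OF linear_Sym])
    have e': "(e has_vector_derivative \<Omega> t + 0) (at t within {0..})" if "t \<ge> 0" for t
      using linear_has_vector_derivative[OF linear_axial Z'[OF that]]
      by (simp add: e_def[abs_def] linear_diff[OF linear_axial] linear_scale[OF linear_axial])
    have y': "(y has_vector_derivative pid_map K\<^sub>P K\<^sub>I K\<^sub>D (y t) + (0, 0, 0)) (at t within {0..})"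
      if "t \<ge> 0" for t
      using pid_state_derivative[OF e'[unfolded e_def[abs_def] Z_def[abs_def]] \<Omega>' that]
      by (simp add: y_def[abs_def] e_def[abs_def] Z_def[abs_def])
    have yt: "norm (y t) \<le> C * exp (- c * t) * norm (y 0)"
      by (rule decay[OF t y']) (use \<epsilon> in \<open>auto simp: zero_prod_def[symmetric]\<close>)
    let ?S = "\<lambda>t. Sym (Z t)"
    have "?S t \<bullet> ?S t \<le> exp (- (4 * k\<^sub>e) * t) * (?S 0 \<bullet> ?S 0)"
    proof (rule exp_decay_of_deriv_le[OF t])
      fix s :: real assume "0 \<le> s"
      then show "((\<lambda>t. ?S t \<bullet> ?S t) has_real_derivative - (4 * k\<^sub>e) * (?S s \<bullet> ?S s)) (at s within {0..})"
        using bounded_bilinear.has_vector_derivative[OF bounded_bilinear_inner S' S', of s]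
        by (simp add: has_real_derivative_iff_has_vector_derivative mult.assoc)
    qed simp
    then have "(norm (?S t))\<^sup>2 \<le> (exp (- (2 * k\<^sub>e) * t) * norm (?S 0))\<^sup>2"
      by (simp add: power2_norm_eq_inner power_mult_distrib mult.assoc flip: exp_double)
    then have "norm (?S t) \<le> exp (- (2 * k\<^sub>e) * t) * norm (?S 0)"
      by (rule power2_le_imp_le) simp
    also have "\<dots> \<le> exp (- m * t) * norm (?S 0)"
      using t by (intro mult_right_mono) (auto simp: m_def intro!: mult_right_mono)
    also have "norm (?S 0) \<le> K * (K * norm (x 0))"
    proof -
      have "norm (?S 0) \<le> K * norm (Z 0)" by (rule K5)
      also have "norm (Z 0) \<le> K * norm (X 0)" unfolding Z_def by (rule K2)
      also have "norm (X 0) \<le> norm (x 0)" unfolding X_def by (rule norm_fst)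
      finally show ?thesis using K by (simp add: mult_left_mono)
    qed
    finally have S: "norm (?S t) \<le> exp (- m * t) * (K * K * norm (x 0))"
      by (simp add: mult.assoc)
    have y0: "norm (y 0) \<le> (K * K + 1) * norm (x 0)"
    proof -
      have "norm (y 0) \<le> norm (e 0) + norm (\<Omega> 0)" by (simp add: y_def norm_Pair_le)
      also have "norm (e 0) \<le> K * norm (Z 0)" unfolding e_def by (rule K3)
      also have "norm (Z 0) \<le> K * norm (X 0)" unfolding Z_def by (rule K2)
      also have "norm (X 0) \<le> norm (x 0)" unfolding X_def by (rule norm_fst)
      also have "norm (\<Omega> 0) \<le> norm (x 0)" unfolding \<Omega>_def by (rule norm_snd)
      finally show ?thesis using K by (simp add: algebra_simps mult_left_mono)
    qed
    have "norm (y t) \<le> C * exp (- m * t) * ((K * K + 1) * norm (x 0))"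
    proof -
      have "C * exp (- c * t) \<le> C * exp (- m * t)"
        using C t by (auto simp: m_def intro!: mult_right_mono)
      with yt y0 C show ?thesis by (intro order_trans[OF yt mult_mono]) auto
    qed
    then have y: "norm (y t) \<le> exp (- m * t) * (C * (K * K + 1) * norm (x 0))"
      by (simp add: algebra_simps)
    have "norm (x t) \<le> norm (X t) + norm (\<Omega> t)" unfolding X_def \<Omega>_def by (rule norm_le_fst_snd)
    also have "norm (X t) \<le> K * norm (Z t)"
      using K1[of "Z t"] by (simp add: Z_def orthogonal_cancel[OF R0])
    also have "norm (Z t) \<le> norm (?S t) + norm (hat (e t))"
      unfolding e_def by (metis Sym_add_hat_axial norm_triangle_ineq)
    also have "norm (hat (e t)) \<le> K * norm (e t)" by (rule K4)
    also have "norm (e t) \<le> norm (y t)"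
      using order_trans[OF norm_fst norm_snd, of "y t"] by (simp add: y_def)
    also have "norm (\<Omega> t) \<le> norm (y t)"
      using order_trans[OF norm_snd norm_snd, of "y t"] by (simp add: y_def)
    also have "K * (norm (?S t) + K * norm (y t)) + norm (y t) = K * norm (?S t) + (K * K + 1) * norm (y t)"
      by (simp add: algebra_simps)
    also have "\<dots> \<le> K * (exp (- m * t) * (K * K * norm (x 0)))
        + (K * K + 1) * (exp (- m * t) * (C * (K * K + 1) * norm (x 0)))"
      using S y K by (intro add_mono mult_left_mono) auto
    also have "\<dots> = C' * exp (- m * t) * norm (x 0)"
      by (simp add: C'_def algebra_simps)
    finally show ?thesis using K by (simp add: mult_left_mono)
  qed
  note decay' = this
  have m: "m > 0" using c k by (simp add: m_def)
  have C': "C' > 0" unfolding C'_def using K C by (intro add_pos_pos mult_pos_pos) auto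
  have "linear_system R\<^sub>0 k\<^sub>e (0, 0) 0 = 0"
    by (simp add: linear_system_def linear_0[OF linear_hat] linear_0[OF linear_Sym]
        linear_0[OF linear_matrix_mult_left] zero_prod_def)
  then have "closed_loop_solution UNIV (linear_system R\<^sub>0 k\<^sub>e)
      (\<lambda>x. pid_control R\<^sub>0 K\<^sub>P K\<^sub>I K\<^sub>D (\<lambda>t. fst (x t)) (\<lambda>t. snd (x t))) (\<lambda>_. (0, 0))"
    by (simp add: closed_loop_solution_def)
  then show ?thesis
    unfolding exponentially_stabilizes_def zero_prod_def[symmetric] diff_0_right
    by (intro conjI exI[of _ C'] exI[of _ m] exI[of _ 1] allI impI C' m decay' zero_less_one)
qed

text \<open>Here \<open>Z' = (I + Z) hat \<Omega>\<close>, so the loop for \<open>y\<close> is perturbed by the axial vector of \<open>Z hat \<Omega>\<close>.\<close>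

lemma rigid_exponentially_stable:
  assumes SO3: "R\<^sub>0 \<in> SO3" and H: "hurwitz (pid_poly K\<^sub>P K\<^sub>I K\<^sub>D)"
  shows "exponentially_stabilizes (SO3 \<times> UNIV) rigid_body_system
           (\<lambda>x. pid_control R\<^sub>0 K\<^sub>P K\<^sub>I K\<^sub>D (\<lambda>t. fst (x t) - R\<^sub>0) (\<lambda>t. snd (x t))) (R\<^sub>0, 0)"
proof -
  have R0: "orthogonal_matrix R\<^sub>0"
    using SO3 by (simp add: SO3_def rotation_matrix_def)
  obtain C c \<epsilon> where C: "C > 0" and c: "c > 0" and \<epsilon>: "\<epsilon> > 0" and decay:
    "\<And>(y :: real \<Rightarrow> (real^3) \<times> (real^3) \<times> (real^3)) g T. T \<ge> 0 \<Longrightarrow>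
       (\<And>t. 0 \<le> t \<Longrightarrow> t \<le> T \<Longrightarrow>
         (y has_vector_derivative pid_map K\<^sub>P K\<^sub>I K\<^sub>D (y t) + g t) (at t within {0..})) \<Longrightarrow>
       (\<And>t. 0 \<le> t \<Longrightarrow> t \<le> T \<Longrightarrow> norm (g t) \<le> \<epsilon> * norm (y t)) \<Longrightarrow>
       norm (y T) \<le> C * exp (- c * T) * norm (y 0)"
    using perturbed_linear_decay[OF linear_pid_map stable_spectrum_pid_map[OF H]] by metis
  obtain K where K: "K \<ge> 1"
    and K1: "\<And>X :: real^3^3. norm (R\<^sub>0 ** X) \<le> K * norm X"
    and K2: "\<And>X :: real^3^3. norm (transpose R\<^sub>0 ** X) \<le> K * norm X"
    and K3: "\<And>X. norm (axial X) \<le> K * norm X" and K4: "\<And>v. norm (hat v) \<le> K * norm v"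
    and K6: "\<And>X :: real^3^3. norm (transpose X) \<le> K * norm X"
    and K7: "\<And>(X :: real^3^3) (Y :: real^3^3). norm (X ** Y) \<le> K * norm X * norm Y"
    using ex_common_bound[of R\<^sub>0] by metis
  \<comment> \<open>The radius within which \<open>Sym Z\<close> is at most half of \<open>Z\<close> and the perturbation is at most
    \<open>\<epsilon>\<close> times \<open>y\<close>.\<close>
  define r where "r = min (1 / (K * K)) (\<epsilon> / (K * K * K))"
  have r: "r > 0" "K * K * r \<le> 1" "K * K * K * r \<le> \<epsilon>"
    using K \<epsilon> by (auto simp: r_def min_def field_simps)
  define L where "L = K * K + 1"
  \<comment> \<open>The first bound starts the continuation inside the radius, the second one keeps it there.\<close>
  define \<delta> where "\<delta> = min (r / K) (r / (2 * K * C * L))"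
  have L: "L > 0" unfolding L_def using K by (simp add: add_nonneg_pos)
  have \<delta>: "\<delta> > 0" using r K C L by (simp add: \<delta>_def)
  have main: "norm (x t - (R\<^sub>0, 0)) \<le> ((2 * K * K + 1) * C * L) * exp (- c * t) * norm (x 0 - (R\<^sub>0, 0))"
    if sol: "closed_loop_solution (SO3 \<times> UNIV) rigid_body_system
       (\<lambda>x. pid_control R\<^sub>0 K\<^sub>P K\<^sub>I K\<^sub>D (\<lambda>t. fst (x t) - R\<^sub>0) (\<lambda>t. snd (x t))) x"
      and init: "norm (x 0 - (R\<^sub>0, 0)) < \<delta>" and t: "t \<ge> 0" for x t
  proof -
    define X where "X t = fst (x t) - R\<^sub>0" for t
    define \<Omega> where "\<Omega> t = snd (x t)" for t
    define Z where "Z t = transpose R\<^sub>0 ** X t" for t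
    define e where "e t = axial (Z t)" for t
    define y where "y t = (integral {0..t} e, e t, \<Omega> t)" for t
    define h where "h t = axial (Z t ** hat (\<Omega> t))" for t
    define d where "d t = norm (x t - (R\<^sub>0, 0))" for t
    let ?u = "pid_control R\<^sub>0 K\<^sub>P K\<^sub>I K\<^sub>D X \<Omega>"
    have xd: "x t - (R\<^sub>0, 0) = (X t, \<Omega> t)" for t
      by (simp add: X_def \<Omega>_def prod_eq_iff)
    have Xd: "norm (X t) \<le> d t" and \<Omega>d: "norm (\<Omega> t) \<le> d t" for t
      unfolding d_def xd by (rule norm_fst_le, rule norm_snd_le)
    have R0Z: "mat 1 + Z t = transpose R\<^sub>0 ** fst (x t)" for t
      using R0 by (simp add: Z_def X_def linear_diff[OF linear_matrix_mult_left] orthogonal_matrix_def)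
    have x': "(x has_vector_derivative (fst (x t) ** hat (\<Omega> t), ?u t)) (at t within {0..})"
      if "t \<ge> 0" for t
      using sol that
      by (simp add: closed_loop_solution_def rigid_body_system_def case_prod_beta X_def[abs_def] \<Omega>_def[abs_def])
    have \<Omega>': "(\<Omega> has_vector_derivative ?u t) (at t within {0..})" if "t \<ge> 0" for t
      using has_vector_derivative_fst_snd(2)[OF x'[OF that]] by (simp add: \<Omega>_def[abs_def])
    have Z': "(Z has_vector_derivative hat (\<Omega> t) + Z t ** hat (\<Omega> t)) (at t within {0..})"
      if "t \<ge> 0" for t
    proof -
      have "(X has_vector_derivative (fst (x t) ** hat (\<Omega> t))) (at t within {0..})"
        using has_vector_derivative_diff[OF has_vector_derivative_fst_snd(1)[OF x'[OF that]]
            has_vector_derivative_const] by (simp add: X_def[abs_def])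
      from linear_has_vector_derivative[OF linear_matrix_mult_left this, of "transpose R\<^sub>0"]
      have "(Z has_vector_derivative (mat 1 + Z t) ** hat (\<Omega> t)) (at t within {0..})"
        unfolding R0Z by (simp add: Z_def[abs_def] matrix_mul_assoc)
      then show ?thesis by (simp add: matrix_add_rdistrib)
    qed
    have e': "(e has_vector_derivative \<Omega> t + h t) (at t within {0..})" if "t \<ge> 0" for t
      using linear_has_vector_derivative[OF linear_axial Z'[OF that]]
      by (simp add: e_def[abs_def] h_def linear_add[OF linear_axial])
    have y': "(y has_vector_derivative pid_map K\<^sub>P K\<^sub>I K\<^sub>D (y t) + (0, h t, 0)) (at t within {0..})"
      if "t \<ge> 0" for t
      using pid_state_derivative[OF e'[unfolded e_def[abs_def] Z_def[abs_def]] \<Omega>' that]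
      by (simp add: y_def[abs_def] e_def[abs_def] Z_def[abs_def])
    have ey: "norm (e t) \<le> norm (y t)" for t
      using order_trans[OF norm_fst norm_snd, of "y t"] by (simp add: y_def)
    have \<Omega>y: "norm (\<Omega> t) \<le> norm (y t)" for t
      using order_trans[OF norm_snd norm_snd, of "y t"] by (simp add: y_def)
    have y0: "norm (y 0) \<le> L * d 0"
    proof -
      have "norm (y 0) \<le> norm (e 0) + norm (\<Omega> 0)" by (simp add: y_def norm_Pair_le)
      also have "norm (e 0) \<le> K * norm (Z 0)" unfolding e_def by (rule K3)
      also have "norm (Z 0) \<le> K * norm (X 0)" unfolding Z_def by (rule K2)
      also have "norm (X 0) \<le> d 0" by (rule Xd)
      also have "norm (\<Omega> 0) \<le> d 0" by (rule \<Omega>d)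
      finally show ?thesis using K by (simp add: L_def algebra_simps mult_left_mono)
    qed
    have h: "norm (h t) \<le> \<epsilon> * norm (y t)" if "norm (Z t) \<le> r" for t
    proof -
      have "norm (h t) \<le> K * norm (Z t ** hat (\<Omega> t))" unfolding h_def by (rule K3)
      also have "norm (Z t ** hat (\<Omega> t)) \<le> K * norm (Z t) * norm (hat (\<Omega> t))" by (rule K7)
      also have "K * norm (Z t) * norm (hat (\<Omega> t)) \<le> K * r * (K * norm (y t))"
        using that K r(1) order_trans[OF K4[of "\<Omega> t"] mult_left_mono[OF \<Omega>y[of t]]]
        by (intro mult_mono) auto
      also have "K * (K * r * (K * norm (y t))) = (K * K * K * r) * norm (y t)"
        by simp
      also have "\<dots> \<le> \<epsilon> * norm (y t)" using r by (intro mult_right_mono) auto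
      finally show ?thesis using K by (simp add: mult_left_mono)
    qed
    have Ze: "norm (Z t) \<le> 2 * K * norm (e t)" if "t \<ge> 0" "norm (Z t) \<le> r" for t
    proof -
      have "orthogonal_matrix (mat 1 + Z t)"
      proof -
        have "orthogonal_matrix (fst (x t))"
          using sol \<open>t \<ge> 0\<close>
          by (auto simp: closed_loop_solution_def SO3_def rotation_matrix_def mem_Times_iff)
        then show ?thesis unfolding R0Z
          using R0 by (intro orthogonal_matrix_mul) (simp_all add: orthogonal_matrix_transpose)
      qed
      from Sym_of_orthogonal[OF this]
      have "norm (Sym (Z t)) = 1/2 * norm (transpose (Z t) ** Z t)" by simp
      also have "norm (transpose (Z t) ** Z t) \<le> K * norm (transpose (Z t)) * norm (Z t)" by (rule K7)
      also have "K * norm (transpose (Z t)) * norm (Z t) \<le> K * (K * r) * norm (Z t)"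
        using that K order_trans[OF K6[of "Z t"] mult_left_mono[OF that(2)]]
        by (intro mult_right_mono mult_left_mono) auto
      also have "\<dots> \<le> 1 * norm (Z t)"
        using r by (intro mult_right_mono) (auto simp: mult.assoc)
      finally have "norm (Sym (Z t)) \<le> norm (Z t) / 2" by simp
      moreover have "norm (Z t) \<le> norm (Sym (Z t)) + norm (hat (e t))"
        unfolding e_def by (metis Sym_add_hat_axial norm_triangle_ineq)
      ultimately show ?thesis using K4[of "e t"] by simp
    qed
    have yT: "norm (y T) \<le> C * exp (- c * T) * (L * d 0)"
      if "T \<ge> 0" "\<And>t. 0 \<le> t \<Longrightarrow> t \<le> T \<Longrightarrow> norm (Z t) \<le> r" for T
    proof -
      have "norm (y T) \<le> C * exp (- c * T) * norm (y 0)"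
        by (rule decay[OF that(1) y']) (use h that(2) in \<open>auto simp: norm_Pair\<close>)
      also have "\<dots> \<le> C * exp (- c * T) * (L * d 0)"
        using C y0 by (intro mult_left_mono) auto
      finally show ?thesis .
    qed
    have Zr: "norm (Z t) < r" if "t \<ge> 0" for t
    proof (rule continuation[OF _ _ that])
      show "continuous_on {0..} (\<lambda>t. norm (Z t))"
        unfolding continuous_on_eq_continuous_within
        by (auto intro!: continuous_norm has_vector_derivative_continuous[OF Z'])
      have "norm (Z 0) \<le> K * norm (X 0)" unfolding Z_def by (rule K2)
      also have "\<dots> \<le> K * d 0" using K Xd by (intro mult_left_mono) auto
      also have "\<dots> < K * (r / K)" 
        using init K by (intro mult_strict_left_mono) (auto simp: d_def \<delta>_def)
      finally show "norm (Z 0) < r" using K by simp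
    next
      fix T :: real assume T: "T \<ge> 0" "\<And>t. 0 \<le> t \<Longrightarrow> t \<le> T \<Longrightarrow> norm (Z t) \<le> r"
      have "norm (Z T) \<le> 2 * K * norm (y T)"
        by (rule order_trans[OF Ze mult_left_mono[OF ey]]) (use T K in auto)
      also have "norm (y T) \<le> C * 1 * (L * d 0)"
      proof -
        have "exp (- c * T) \<le> 1" using c T by simp
        then have "C * exp (- c * T) * (L * d 0) \<le> C * 1 * (L * d 0)"
          using C L by (intro mult_right_mono mult_left_mono) (auto simp: d_def)
        with yT[OF T] show ?thesis by linarith
      qed
      also have "2 * K * (C * 1 * (L * d 0)) = (2 * K * C * L) * d 0" by simp
      also have "\<dots> < (2 * K * C * L) * (r / (2 * K * C * L))"
        using init K C L by (intro mult_strict_left_mono) (auto simp: d_def \<delta>_def)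
      also have "\<dots> = r" using K C L by simp
      finally show "norm (Z T) < r" using K by (simp add: mult_left_mono)
    qed
    have "d t \<le> norm (X t) + norm (\<Omega> t)" unfolding d_def xd by (rule norm_Pair_le)
    also have "norm (X t) \<le> K * norm (Z t)"
      using K1[of "Z t"] by (simp add: Z_def orthogonal_cancel[OF R0])
    also have "norm (Z t) \<le> 2 * K * norm (e t)" using Ze Zr t by (simp add: less_imp_le)
    also have "norm (e t) \<le> norm (y t)" by (rule ey)
    also have "norm (\<Omega> t) \<le> norm (y t)" by (rule \<Omega>y)
    also have "K * (2 * K * norm (y t)) + norm (y t) = (2 * K * K + 1) * norm (y t)"
      by (simp add: algebra_simps)
    also have "\<dots> \<le> (2 * K * K + 1) * (C * exp (- c * t) * (L * d 0))"
      using yT[OF t] Zr K by (intro mult_left_mono) (auto simp: less_imp_le)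
    finally have "d t \<le> (2 * K * K + 1) * (C * exp (- c * t) * (L * d 0))"
      using K by (simp add: mult_left_mono)
    then show ?thesis by (simp add: d_def algebra_simps)
  qed
  have C': "(2 * K * K + 1) * C * L > 0"
    using K C L by (intro mult_pos_pos) (auto intro: add_nonneg_pos)
  have "rigid_body_system (R\<^sub>0, 0) 0 = 0"
    by (simp add: rigid_body_system_def linear_0[OF linear_hat]
        linear_0[OF linear_matrix_mult_left] zero_prod_def)
  then have "closed_loop_solution (SO3 \<times> UNIV) rigid_body_system
      (\<lambda>x. pid_control R\<^sub>0 K\<^sub>P K\<^sub>I K\<^sub>D (\<lambda>t. fst (x t) - R\<^sub>0) (\<lambda>t. snd (x t))) (\<lambda>_. (R\<^sub>0, 0))"
    using SO3 by (simp add: closed_loop_solution_def)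
  then show ?thesis
    unfolding exponentially_stabilizes_def
    by (intro conjI exI[of _ "(2 * K * K + 1) * C * L"] exI[of _ c] exI[of _ \<delta>] allI impI
        C' c \<delta> main)
qed

theorem mainTheorem4:
  fixes R\<^sub>0 K\<^sub>P K\<^sub>I K\<^sub>D :: "real^3^3" and k\<^sub>e :: real
  assumes "R\<^sub>0 \<in> SO3" and "k\<^sub>e > 0"
    and "hurwitz (pid_poly K\<^sub>P K\<^sub>I K\<^sub>D)"
  shows "exponentially_stabilizes UNIV (linear_system R\<^sub>0 k\<^sub>e)
           (\<lambda>x. pid_control R\<^sub>0 K\<^sub>P K\<^sub>I K\<^sub>D (\<lambda>t. fst (x t)) (\<lambda>t. snd (x t))) (0, 0)
       \<and> exponentially_stabilizes (SO3 \<times> UNIV) rigid_body_system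
           (\<lambda>x. pid_control R\<^sub>0 K\<^sub>P K\<^sub>I K\<^sub>D (\<lambda>t. fst (x t) - R\<^sub>0) (\<lambda>t. snd (x t))) (R\<^sub>0, 0)"
proof -
  have "orthogonal_matrix R\<^sub>0"
    using assms(1) by (simp add: SO3_def rotation_matrix_def)
  with assms show ?thesis
    using linear_exponentially_stable rigid_exponentially_stable by blast
qed

end
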